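(* Let $\Theta_0\subseteq\Theta$, and consider testing $\mathrm H_0:\theta\in\Theta_0$ against $\mathrm H_1:\theta\in\Theta\setminus\Theta_0$ with sequentially arriving i.i.d. data $X_1,X_2,\dots$. For $n\in\mathbb N$ put $$P_n=1/M_{\boldsymbol\alpha,\boldsymbol\beta,n},\qquad \tilde P_n=\min_{s\le n}\,(1/M_{\boldsymbol\alpha,\boldsymbol\beta,s}).$$ Then for any $\mathbb N$-valued random variable $N$, not necessarily a stopping time, $P_N$ and $\tilde P_N$ are valid $p$-values; that is, for all $\alpha\in[0,1]$, $$\sup_{\theta^*\in\Theta_0}\mathrm{Pr}_{\theta^*}(P_N\le\alpha)\le\alpha\quad\text{and}\quad \sup_{\theta^*\in\Theta_0}\mathrm{Pr}_{\theta^*}(\tilde P_N\le\alpha)\le\alpha .$$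
   Context: Model. $d,q\in\mathbb N$, $\mathbb X\subseteq\mathbb R^d$, $\Theta\subseteq\mathbb R^q$. $\{\mathcal P_\theta:\theta\in\Theta\}$ is a parametric family of distributions on $\mathbb X$ with probability density or mass functions $p(x;\theta)$ ("PDF" means PDF or PMF throughout). $\mathrm{Pr}_{\theta^*}$ is probability when the data $X_1,X_2,\dots$ are i.i.d. from $\mathcal P_{\theta^*}$, i.e. with PDF $p(x;\theta^* )$. Index sets. $[d]=\{1,\dots,d\}$; $\mathbb S_d$ is the set of all non-empty subsets of $[d]$; $\mathbb T_d$ is the set of all ordered pairs $T=(\overleftarrow T,\overrightarrow T)$ of disjoint non-empty subsets of $[d]$ (their union need not be $[d]$; so $|\mathbb T_d|=3^d-2^{d+1}+1$). For $x\in\mathbb R^d$ and $S\subseteq[d]$, $x_S$ is the subvector of coordinates indexed by $S$. $p(x_S;\theta)$ denotes the marginal PDF of $X_S$ and $p(x_{\overleftarrow T}\mid x_{\overrightarrow T};\theta)$ the conditional PDF of $X_{\overleftarrow T}$ given $X_{\overrightarrow T}=x_{\overrightarrow T}$ when $X\sim\mathcal P_\theta$ (a fixed version, which is a PDF in $x_{\overleftarrow T}$ for each $x_{\overrightarrow T}$). Composite likelihood. Fixed weights $\alpha_S\ge0$ ($S\in\mathbb S_d$), $\beta_T\ge0$ ($T\in\mathbb T_d$), collected in $\boldsymbol\alpha=(\alpha_S)_{S}$, $\boldsymbol\beta=(\beta_T)_{T}$, satisfy $\gamma=\sum_{S\in\mathbb S_d}\alpha_S+\sum_{T\in\mathbb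 T_d}\beta_T>0$. The individual composite likelihood is $$p_{\boldsymbol\alpha,\boldsymbol\beta}(x;\theta)=\prod_{S\in\mathbb S_d}[p(x_S;\theta)]^{\alpha_S/\gamma}\prod_{T\in\mathbb T_d}[p(x_{\overleftarrow T}\mid x_{\overrightarrow T};\theta)]^{\beta_T/\gamma}$$ (with $0^0=1$). The weights are unrelated to the scalar level $\alpha$. Sequential statistic. Write $\mathbf X_n=(X_1,\dots,X_n)$. For each $n\in\mathbb N$, $\tilde\theta^1_{n-1}$ is an arbitrary $\Theta$-valued non-anticipating estimator, i.e. a (measurable) function of $\mathbf X_{n-1}$ only (so $\tilde\theta^1_0$ is non-random). Let $$\hat\theta_n^0\in\underset{\theta\in\Theta_0}{\arg\max}\;\prod_{i=1}^n p_{\boldsymbol\alpha,\boldsymbol\beta}(X_i;\theta)$$ be the maximum composite likelihood estimator over $\Theta_0$ based on $\mathbf X_n$ (assumed to exist and be measurable). The running test statistic is $$M_{\boldsymbol\alpha,\boldsymbol\beta,n}=\frac{\prod_{i=1}^n p_{\boldsymbol\alpha,\boldsymbol\beta}(X_i;\tilde\theta^1_{i-1})}{\prod_{i=1}^n p_{\boldsymbol\alpha,\boldsymbol\beta}(X_i;\hat\theta^0_n)},$$ with the convention $1/0=+\infty$ when forming $1/M_{\boldsymbol\alpha,\boldsymbol\beta,n}$. The random variable $N$ may depend arbitrarily on the whole data sequence (and is defined on the same probability space). *)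

theory Defs
  imports "HOL-Probability.Probability"
begin

datatype pdf_kind = Density | Mass

text \<open>The subvector with coordinates in \<open>S\<close> is a function that is extensional on \<open>S\<close>.\<close>

definition subvec :: "'d::finite set \<Rightarrow> real ^ 'd \<Rightarrow> 'd \<Rightarrow> real" where
  "subvec S x = restrict (vec_nth x) S"

abbreviation borel_on :: "'d::finite set \<Rightarrow> ('d \<Rightarrow> real) measure" where
  "borel_on S \<equiv> PiM S (\<lambda>_. borel)"

fun dominating :: "pdf_kind \<Rightarrow> 'd::finite set \<Rightarrow> ('d \<Rightarrow> real) measure" where
  "dominating Density S = PiM S (\<lambda>_. lborel)"
| "dominating Mass S = count_space (PiE S (\<lambda>_. UNIV))"

definition is_pdf :: "pdf_kind \<Rightarrow> 'd::finite set \<Rightarrow> (('d \<Rightarrow> real) \<Rightarrow> real) \<Rightarrow> bool" where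
  "is_pdf k S f \<longleftrightarrow>
     f \<in> borel_measurable (borel_on S) \<and> (\<forall>x\<in>space (borel_on S). 0 \<le> f x) \<and>
     (\<integral>\<^sup>+x. ennreal (f x) \<partial>dominating k S) = 1"

text \<open>\<open>f\<close> is a PDF of \<open>X\<^sub>S\<close> when \<open>X\<close> has law \<open>P\<close>. The outer \<open>distr\<close> on the right only restricts
  the density measure to the Borel sets; for \<open>k = Mass\<close> it lives on the power set.\<close>

definition has_marginal_pdf ::
    "pdf_kind \<Rightarrow> (real ^ 'd) measure \<Rightarrow> 'd::finite set \<Rightarrow> (('d \<Rightarrow> real) \<Rightarrow> real) \<Rightarrow> bool" where
  "has_marginal_pdf k P S f \<longleftrightarrow> is_pdf k S f \<and>
     distr P (borel_on S) (subvec S) =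
       distr (density (dominating k S) (\<lambda>x. ennreal (f x))) (borel_on S) (\<lambda>x. x)"

text \<open>\<open>f a b\<close> is a version of the conditional PDF of \<open>X\<^sub>A\<close> at \<open>a\<close> given \<open>X\<^sub>B = b\<close>, where \<open>g\<close> is the
  PDF of \<open>X\<^sub>B\<close>: it is a PDF in \<open>a\<close> for \<^emph>\<open>every\<close> \<open>b\<close>, and \<open>f a b * g b\<close> is a joint PDF.\<close>

definition has_conditional_pdf ::
    "pdf_kind \<Rightarrow> (real ^ 'd) measure \<Rightarrow> 'd::finite set \<Rightarrow> 'd set \<Rightarrow>
     (('d \<Rightarrow> real) \<Rightarrow> real) \<Rightarrow> (('d \<Rightarrow> real) \<Rightarrow> ('d \<Rightarrow> real) \<Rightarrow> real) \<Rightarrow> bool" where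
  "has_conditional_pdf k P A B g f \<longleftrightarrow>
     (\<forall>b\<in>space (borel_on B). is_pdf k A (\<lambda>a. f a b)) \<and>
     (\<lambda>z. f (restrict z A) (restrict z B)) \<in> borel_measurable (borel_on (A \<union> B)) \<and>
     has_marginal_pdf k P (A \<union> B) (\<lambda>z. f (restrict z A) (restrict z B) * g (restrict z B))"

definition subset_index :: "'d::finite set set" where
  "subset_index = {S. S \<noteq> {}}"

text \<open>In \<open>(A, B)\<close>, the coordinates in \<open>A\<close> are conditioned on those in \<open>B\<close>.\<close>

definition pair_index :: "('d::finite set \<times> 'd set) set" where
  "pair_index = {(A, B). A \<noteq> {} \<and> B \<noteq> {} \<and> A \<inter> B = {}}"

definition total_weight ::
    "('d::finite set \<Rightarrow> real) \<Rightarrow> ('d set \<times> 'd set \<Rightarrow> real) \<Rightarrow> real" where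
  "total_weight \<alpha> \<beta> = (\<Sum>S\<in>subset_index. \<alpha> S) + (\<Sum>T\<in>pair_index. \<beta> T)"

text \<open>Real power with \<open>0\<^sup>0 = 1\<close>, whereas \<open>0 powr 0 = 0\<close>.\<close>

definition rpow :: "real \<Rightarrow> real \<Rightarrow> real" where
  "rpow x a = (if a = 0 then 1 else x powr a)"

definition composite_likelihood ::
    "('d::finite set \<Rightarrow> real) \<Rightarrow> ('d set \<times> 'd set \<Rightarrow> real) \<Rightarrow>
     ('d set \<Rightarrow> ('d \<Rightarrow> real) \<Rightarrow> 't \<Rightarrow> real) \<Rightarrow>
     ('d set \<times> 'd set \<Rightarrow> ('d \<Rightarrow> real) \<Rightarrow> ('d \<Rightarrow> real) \<Rightarrow> 't \<Rightarrow> real) \<Rightarrow>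
     real ^ 'd \<Rightarrow> 't \<Rightarrow> real" where
  "composite_likelihood \<alpha> \<beta> pm pc x \<theta> =
     (\<Prod>S\<in>subset_index. rpow (pm S (subvec S x) \<theta>) (\<alpha> S / total_weight \<alpha> \<beta>)) *
     (\<Prod>T\<in>pair_index. rpow (pc T (subvec (fst T) x) (subvec (snd T) x) \<theta>)
                            (\<beta> T / total_weight \<alpha> \<beta>))"

text \<open>Below, \<open>L x \<theta>\<close> is an individual likelihood and \<open>x\<close> a data sequence \<open>x 1, x 2, \<dots>\<close> (\<open>x 0\<close> is never
  used). An estimator based on the first \<open>n\<close> observations only sees \<open>restrict x {1..n}\<close>.\<close>

definition plugin_likelihood ::
    "('x \<Rightarrow> 't \<Rightarrow> real) \<Rightarrow> (nat \<Rightarrow> (nat \<Rightarrow> 'x) \<Rightarrow> 't) \<Rightarrow> nat \<Rightarrow> (nat \<Rightarrow> 'x) \<Rightarrow> real" where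
  "plugin_likelihood L est1 n x = (\<Prod>i=1..n. L (x i) (est1 (i - 1) (restrict x {1..i - 1})))"

definition max_likelihood ::
    "('x \<Rightarrow> 't \<Rightarrow> real) \<Rightarrow> (nat \<Rightarrow> (nat \<Rightarrow> 'x) \<Rightarrow> 't) \<Rightarrow> nat \<Rightarrow> (nat \<Rightarrow> 'x) \<Rightarrow> real" where
  "max_likelihood L est0 n x = (\<Prod>i=1..n. L (x i) (est0 n (restrict x {1..n})))"

definition running_stat ::
    "('x \<Rightarrow> 't \<Rightarrow> real) \<Rightarrow> (nat \<Rightarrow> (nat \<Rightarrow> 'x) \<Rightarrow> 't) \<Rightarrow> (nat \<Rightarrow> (nat \<Rightarrow> 'x) \<Rightarrow> 't) \<Rightarrow>
     nat \<Rightarrow> (nat \<Rightarrow> 'x) \<Rightarrow> ennreal" where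
  "running_stat L est1 est0 n x =
     ennreal (plugin_likelihood L est1 n x) / ennreal (max_likelihood L est0 n x)"

text \<open>In \<open>ennreal\<close>, \<open>1 / 0 = \<infinity>\<close>; also \<open>0 / 0 = 0\<close>, so the p-statistic is \<open>\<infinity>\<close> when both likelihoods vanish.\<close>

definition p_stat ::
    "('x \<Rightarrow> 't \<Rightarrow> real) \<Rightarrow> (nat \<Rightarrow> (nat \<Rightarrow> 'x) \<Rightarrow> 't) \<Rightarrow> (nat \<Rightarrow> (nat \<Rightarrow> 'x) \<Rightarrow> 't) \<Rightarrow>
     nat \<Rightarrow> (nat \<Rightarrow> 'x) \<Rightarrow> ennreal" where
  "p_stat L est1 est0 n x = 1 / running_stat L est1 est0 n x"

definition p_stat_min ::
    "('x \<Rightarrow> 't \<Rightarrow> real) \<Rightarrow> (nat \<Rightarrow> (nat \<Rightarrow> 'x) \<Rightarrow> 't) \<Rightarrow> (nat \<Rightarrow> (nat \<Rightarrow> 'x) \<Rightarrow> 't) \<Rightarrow>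
     nat \<Rightarrow> (nat \<Rightarrow> 'x) \<Rightarrow> ennreal" where
  "p_stat_min L est1 est0 n x = (MIN s\<in>{1..n}. 1 / running_stat L est1 est0 s x)"

text \<open>Measurability of \<open>P\<close> is included because \<open>emeasure\<close> is \<open>0\<close> on non-measurable sets.\<close>

definition valid_p_value ::
    "'w measure \<Rightarrow> ('t \<Rightarrow> 'w measure) \<Rightarrow> 't set \<Rightarrow> ('w \<Rightarrow> ennreal) \<Rightarrow> bool" where
  "valid_p_value F Pr \<Theta>0 P \<longleftrightarrow> P \<in> borel_measurable F \<and>
     (\<forall>a::real. 0 \<le> a \<and> a \<le> 1 \<longrightarrow>
        (SUP \<theta>\<in>\<Theta>0. emeasure (Pr \<theta>) {\<omega> \<in> space F. P \<omega> \<le> ennreal a}) \<le> ennreal a)"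

end

theory Submission
  imports Defs
begin

text \<open>Fix \<open>\<theta>\<close> in the null hypothesis. The ratio \<open>L x \<theta>' / L x \<theta>\<close> of composite likelihoods is a weighted
  geometric mean of marginal and conditional density ratios, each with expectation at most 1 under
  \<open>\<theta>\<close>, so by the weighted AM-GM inequality its own expectation is at most 1. Hence the plug-in
  likelihood divided by the likelihood of \<open>\<theta>\<close> is a nonnegative supermartingale \<open>Y\<close>. Almost surely it
  dominates the running statistic, because the denominator of the latter is a maximum over the null
  hypothesis, and Ville's inequality bounds the probability that \<open>Y\<close> ever reaches \<open>1 / a\<close> by \<open>a\<close>. As this
  controls all times simultaneously, \<open>N\<close> may be arbitrary.\<close>

section \<open>Real powers and the weighted AM-GM inequality\<close>

lemma rpow_nonneg: "0 \<le> rpow x a"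
  by (simp add: rpow_def)

lemma rpow_pos: "0 < x \<Longrightarrow> 0 < rpow x a"
  by (simp add: rpow_def)

lemma rpow_divide: "rpow (x / y) a = rpow x a / rpow y a"
  by (simp add: rpow_def powr_divide)

lemma borel_measurable_rpow [measurable (raw)]:
  assumes [measurable]: "f \<in> borel_measurable M"
  shows "(\<lambda>x. rpow (f x) a) \<in> borel_measurable M"
  unfolding rpow_def by measurable

lemma prod_rpow_le_sum:
  assumes fin: "finite I"
    and r: "\<And>i. i \<in> I \<Longrightarrow> 0 \<le> r i"
    and w: "\<And>i. i \<in> I \<Longrightarrow> 0 \<le> w i" "sum w I = 1"
  shows "(\<Prod>i\<in>I. rpow (r i) (w i)) \<le> (\<Sum>i\<in>I. w i * r i)"
proof -
  \<comment> \<open>An index of weight zero contributes a factor 1 and a summand 0. Dropping it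
    leaves ordinary powers and confines the positivity question to indices that count.\<close>
  define J where "J = {i \<in> I. w i \<noteq> 0}"
  have J: "finite J" "J \<subseteq> I"
    using fin by (auto simp: J_def)
  have "sum w J = sum w I"
    using fin by (intro sum.mono_neutral_left) (auto simp: J_def)
  with w(2) have J_1: "sum w J = 1"
    by (rule trans[rotated])
  have prod_J: "(\<Prod>i\<in>I. rpow (r i) (w i)) = (\<Prod>i\<in>J. r i powr w i)"
    using fin by (intro prod.mono_neutral_cong_right) (auto simp: J_def rpow_def)
  have sum_J: "(\<Sum>i\<in>I. w i * r i) = (\<Sum>i\<in>J. w i * r i)"
    using fin by (intro sum.mono_neutral_cong_right) (auto simp: J_def)
  show ?thesis
  proof (cases "\<exists>i\<in>J. r i = 0")
    case True
    then have "(\<Prod>i\<in>J. r i powr w i) = 0"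
      using J by auto
    with prod_J show ?thesis
      using r w by (simp add: sum_nonneg)
  next
    case False
    then have pos: "0 < r i" if "i \<in> J" for i
      using r[of i] J that by (metis order_le_less subsetD)
    have "(\<Prod>i\<in>J. r i powr w i) = (\<Prod>i\<in>J. exp (w i *\<^sub>R ln (r i)))"
    proof (rule prod.cong)
      show "r i powr w i = exp (w i *\<^sub>R ln (r i))" if "i \<in> J" for i
        using pos[OF that] by (simp add: powr_def)
    qed simp
    also have "\<dots> = exp (\<Sum>i\<in>J. w i *\<^sub>R ln (r i))"
      using J by (simp add: exp_sum)
    also have "\<dots> \<le> (\<Sum>i\<in>J. w i * exp (ln (r i)))"
      using J J_1 w by (intro convex_on_sum[OF _ _ exp_convex]) auto
    finally show ?thesis
      using pos by (simp add: prod_J sum_J)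
  qed
qed

section \<open>Dominating measures and their iterated integrals\<close>

lemma sets_dominating_Density: "sets (dominating Density S) = sets (borel_on S)"
  using sets_PiM_cong[of S S "\<lambda>_. lborel" "\<lambda>_. borel"] by simp

lemma space_dominating: "space (dominating k S) = space (borel_on S)"
  by (cases k) (auto simp: space_PiM)

text \<open>For densities the sigma-algebras agree; for masses the power set makes every map between
  the spaces measurable. This lets both kinds be treated alike below.\<close>

lemma measurable_dominating:
  assumes f: "f \<in> measurable (borel_on S) M"
  shows "f \<in> measurable (dominating k S) M"
proof (cases k)
  case Density
  then show ?thesis
    using f measurable_cong_sets[OF sets_dominating_Density[of S] refl] by blast
next
  case Mass
  then show ?thesis
    using measurable_space[OF f] by (simp add: space_PiM)
qed

text \<open>Tonelli for counting measures on possibly uncountable sets, where sigma-finiteness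
  fails. Indicators move the problem to the whole type, for which
  \<open>nn_integral_fst_count_space\<close> is available.\<close>

lemma nn_integral_count_space_prod:
  "(\<integral>\<^sup>+z. f z \<partial>count_space (A \<times> B)) = (\<integral>\<^sup>+x. \<integral>\<^sup>+y. f (x, y) \<partial>count_space B \<partial>count_space A)"
proof -
  have "(\<integral>\<^sup>+z. f z \<partial>count_space (A \<times> B)) =
      (\<integral>\<^sup>+z. f z * indicator A (fst z) * indicator B (snd z) \<partial>count_space UNIV)"
    by (subst nn_integral_count_space_indicator)
       (auto intro!: nn_integral_cong simp: indicator_def)
  also have "\<dots> = (\<integral>\<^sup>+x. \<integral>\<^sup>+y. f (x, y) * indicator A x * indicator B y \<partial>count_space UNIV \<partial>count_space UNIV)"
    by (subst nn_integral_fst_count_space[symmetric]) simp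
  also have "\<dots> = (\<integral>\<^sup>+x. (\<integral>\<^sup>+y. f (x, y) * indicator B y \<partial>count_space UNIV) * indicator A x \<partial>count_space UNIV)"
    by (auto intro!: nn_integral_cong simp: indicator_def)
  finally show ?thesis
    by (simp add: nn_integral_count_space_indicator)
qed

lemma bij_betw_merge:
  assumes "I \<inter> J = {}"
  shows "bij_betw (merge I J) (PiE I F \<times> PiE J F) (PiE (I \<union> J) F)"
proof (rule bij_betw_byWitness[where f' = "\<lambda>z. (restrict z I, restrict z J)"])
  show "\<forall>p\<in>PiE I F \<times> PiE J F. (restrict (merge I J p) I, restrict (merge I J p) J) = p"
    using assms by (auto simp: PiE_restrict)
  show "\<forall>z\<in>PiE (I \<union> J) F. merge I J (restrict z I, restrict z J) = z"
    by (auto simp: merge_def fun_eq_iff PiE_def extensional_def)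
  show "merge I J ` (PiE I F \<times> PiE J F) \<subseteq> PiE (I \<union> J) F"
    using assms by (auto simp: PiE_def merge_def extensional_def)
  show "(\<lambda>z. (restrict z I, restrict z J)) ` PiE (I \<union> J) F \<subseteq> PiE I F \<times> PiE J F"
    by (auto simp: PiE_def)
qed

text \<open>Tonelli for Lebesgue measure in one case, splitting a sum along the bijection
  \<open>merge B A\<close> in the other. The block \<open>A\<close> is placed inside because a
  conditional PDF integrates to 1 over \<open>A\<close> with \<open>b\<close> fixed.\<close>

lemma nn_integral_dominating_Un:
  assumes AB: "A \<inter> B = {}" and h: "h \<in> borel_measurable (borel_on (A \<union> B))"
  shows "(\<integral>\<^sup>+z. h z \<partial>dominating k (A \<union> B)) =
    (\<integral>\<^sup>+b. \<integral>\<^sup>+a. h (merge B A (b, a)) \<partial>dominating k A \<partial>dominating k B)"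
proof (cases k)
  case Density
  interpret product_sigma_finite "\<lambda>_. lborel :: real measure"
    by standard
  show ?thesis
    using AB measurable_dominating[OF h, of Density]
    by (auto simp: Density Un_commute[of A B] intro!: product_nn_integral_fold)
next
  case Mass
  have bij: "bij_betw (merge B A) (PiE B (\<lambda>_. UNIV) \<times> PiE A (\<lambda>_. UNIV :: real set)) (PiE (A \<union> B) (\<lambda>_. UNIV))"
    using bij_betw_merge[of B A] AB by (simp add: Un_commute Int_commute)
  show ?thesis
    by (simp add: Mass nn_integral_bij_count_space[OF bij, symmetric] nn_integral_count_space_prod)
qed

section \<open>Expected ratios of marginal and conditional densities\<close>

lemma subvec_measurable:
  assumes "sets P = sets (restrict_space borel \<X>)"
  shows "subvec S \<in> measurable P (borel_on S)"
proof -
  have "subvec S \<in> measurable (restrict_space borel \<X>) (borel_on S)"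
    unfolding subvec_def
    by (intro measurable_restrict measurable_restrict_space1) (auto intro: borel_measurable_continuous_onI continuous_intros)
  then show ?thesis
    using measurable_cong_sets[OF assms refl] by blast
qed

lemma restrict_subvec: "A \<subseteq> S \<Longrightarrow> restrict (subvec S x) A = subvec A x"
  by (auto simp: subvec_def Int_absorb1)

lemma subvec_in_space: "subvec S x \<in> space (borel_on S)"
  by (simp add: subvec_def space_PiM)

lemma nn_integral_marginal:
  assumes P: "subvec S \<in> measurable P (borel_on S)"
    and f: "has_marginal_pdf k P S f"
    and h: "h \<in> borel_measurable (borel_on S)"
  shows "(\<integral>\<^sup>+x. h (subvec S x) \<partial>P) = (\<integral>\<^sup>+z. ennreal (f z) * h z \<partial>dominating k S)"
proof -
  have f': "f \<in> borel_measurable (borel_on S)" and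
    eq: "distr P (borel_on S) (subvec S) =
       distr (density (dominating k S) (\<lambda>x. ennreal (f x))) (borel_on S) (\<lambda>x. x)"
    using f by (auto simp: has_marginal_pdf_def is_pdf_def)
  note [measurable] = measurable_dominating[OF f', of k] measurable_dominating[OF h, of k]
  \<comment> \<open>For masses the density measure carries the power set, so the identity map to the
    Borel sets coarsens the sigma-algebra.\<close>
  have id: "(\<lambda>x. x) \<in> measurable (density (dominating k S) (\<lambda>x. ennreal (f x))) (borel_on S)"
    using measurable_dominating[OF measurable_ident_sets[OF refl], where S = S and k = k] by (simp add: id_def)
  have "(\<integral>\<^sup>+x. h (subvec S x) \<partial>P) = (\<integral>\<^sup>+z. h z \<partial>distr P (borel_on S) (subvec S))"
    using P h by (simp add: nn_integral_distr)
  also have "\<dots> = (\<integral>\<^sup>+z. h z \<partial>density (dominating k S) (\<lambda>x. ennreal (f x)))"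
    using id h by (simp add: eq nn_integral_distr)
  finally show ?thesis
    by (simp add: nn_integral_density)
qed

text \<open>The probability of the set where \<open>f\<close> is not positive is the integral of
  \<open>f\<close> over that set, hence 0.\<close>

lemma AE_marginal_pdf_pos:
  assumes P: "subvec S \<in> measurable P (borel_on S)"
    and f: "has_marginal_pdf k P S f"
  shows "AE x in P. 0 < f (subvec S x)"
proof -
  have [measurable]: "f \<in> borel_measurable (borel_on S)"
    using f by (simp add: has_marginal_pdf_def is_pdf_def)
  note [measurable] = P
  define h :: "('a \<Rightarrow> real) \<Rightarrow> ennreal" where "h = indicator {z \<in> space (borel_on S). f z \<le> 0}"
  have h [measurable]: "h \<in> borel_measurable (borel_on S)"
    unfolding h_def by measurable
  have "(\<integral>\<^sup>+x. h (subvec S x) \<partial>P) = (\<integral>\<^sup>+z. ennreal (f z) * h z \<partial>dominating k S)"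
    by (rule nn_integral_marginal[OF P f h])
  also have "\<dots> = 0"
    by (subst nn_integral_0_iff_AE[OF measurable_dominating])
       (auto simp: h_def indicator_def ennreal_eq_0_iff)
  finally have "AE x in P. h (subvec S x) = 0"
    by (subst (asm) nn_integral_0_iff_AE) auto
  then show ?thesis
    by eventually_elim (auto simp: h_def subvec_in_space indicator_def split: if_splits)
qed

text \<open>Not an equality: the left-hand side misses the mass of \<open>g\<close> where \<open>f = 0\<close>, as \<open>y / 0 = 0\<close>.\<close>

lemma nn_integral_marginal_ratio_le:
  assumes P: "subvec S \<in> measurable P (borel_on S)"
    and f: "has_marginal_pdf k P S f"
    and g: "g \<in> borel_measurable (borel_on S)"
  shows "(\<integral>\<^sup>+x. ennreal (g (subvec S x) / f (subvec S x)) \<partial>P) \<le> (\<integral>\<^sup>+z. ennreal (g z) \<partial>dominating k S)"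
proof -
  note [measurable] = g
  have [measurable]: "f \<in> borel_measurable (borel_on S)"
    using f by (simp add: has_marginal_pdf_def is_pdf_def)
  have "(\<integral>\<^sup>+x. ennreal (g (subvec S x) / f (subvec S x)) \<partial>P) =
      (\<integral>\<^sup>+z. ennreal (f z) * ennreal (g z / f z) \<partial>dominating k S)"
    by (rule nn_integral_marginal[OF P f]) measurable
  also have "\<dots> \<le> (\<integral>\<^sup>+z. ennreal (g z) \<partial>dominating k S)"
  proof (rule nn_integral_mono)
    fix z
    assume "z \<in> space (dominating k S)"
    then have "0 \<le> f z"
      using f by (simp add: has_marginal_pdf_def is_pdf_def space_dominating)
    then show "ennreal (f z) * ennreal (g z / f z) \<le> ennreal (g z)"
      by (cases "f z = 0") (auto simp flip: ennreal_mult')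
  qed
  finally show ?thesis .
qed

text \<open>Multiplying both conditional densities by the marginal \<open>g\<close> turns the
  denominator into the joint density of \<open>X\<close> on \<open>A \<union> B\<close> under
  \<open>P\<close>, which reduces the claim to the bound for marginals. The new numerator
  \<open>f' * g\<close> is a hybrid of two laws, yet integrates to 1: first over \<open>A\<close>,
  then over \<open>B\<close>.\<close>

lemma
  assumes P: "\<And>S. subvec S \<in> measurable P (borel_on S)"
    and AB: "A \<inter> B = {}"
    and g: "has_marginal_pdf k P B g"
    and f: "has_conditional_pdf k P A B g f"
  shows AE_conditional_pdf_pos: "AE x in P. 0 < f (subvec A x) (subvec B x)"
    and nn_integral_conditional_ratio_le:
      "has_conditional_pdf k P' A B g' f' \<Longrightarrow>
        (\<integral>\<^sup>+x. ennreal (f' (subvec A x) (subvec B x) / f (subvec A x) (subvec B x)) \<partial>P) \<le> 1"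
proof -
  have joint: "has_marginal_pdf k P (A \<union> B) (\<lambda>z. f (restrict z A) (restrict z B) * g (restrict z B))"
    using f by (simp add: has_conditional_pdf_def)
  have g_pos: "AE x in P. 0 < g (subvec B x)"
    by (rule AE_marginal_pdf_pos[OF P g])
  show "AE x in P. 0 < f (subvec A x) (subvec B x)"
    using AE_marginal_pdf_pos[OF P joint] g_pos
    by eventually_elim (simp add: restrict_subvec zero_less_mult_iff)
  assume f': "has_conditional_pdf k P' A B g' f'"
  have g_meas: "g \<in> borel_measurable (borel_on B)"
    using g by (simp add: has_marginal_pdf_def is_pdf_def)
  have [measurable]: "(\<lambda>z. f' (restrict z A) (restrict z B)) \<in> borel_measurable (borel_on (A \<union> B))"
    using f' by (simp add: has_conditional_pdf_def)
  have [measurable]: "(\<lambda>z. g (restrict z B)) \<in> borel_measurable (borel_on (A \<union> B))"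
    by (rule measurable_compose[OF measurable_restrict_subset g_meas]) auto
  let ?h = "\<lambda>z. f' (restrict z A) (restrict z B) * g (restrict z B)"
  have h: "?h \<in> borel_measurable (borel_on (A \<union> B))"
    by measurable
  \<comment> \<open>Expanding by \<open>g\<close> changes the quotient only where \<open>g\<close>
    vanishes, which is a null event under \<open>P\<close>.\<close>
  have "(\<integral>\<^sup>+x. ennreal (f' (subvec A x) (subvec B x) / f (subvec A x) (subvec B x)) \<partial>P) =
    (\<integral>\<^sup>+x. ennreal (?h (subvec (A \<union> B) x) /
       (f (restrict (subvec (A \<union> B) x) A) (restrict (subvec (A \<union> B) x) B) * g (restrict (subvec (A \<union> B) x) B))) \<partial>P)"
    by (rule nn_integral_cong_AE) (use g_pos in eventually_elim, simp add: restrict_subvec)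
  also have "\<dots> \<le> (\<integral>\<^sup>+z. ennreal (?h z) \<partial>dominating k (A \<union> B))"
    by (rule nn_integral_marginal_ratio_le[OF P joint h])
  also have "\<dots> = (\<integral>\<^sup>+b. \<integral>\<^sup>+a. ennreal (?h (merge B A (b, a))) \<partial>dominating k A \<partial>dominating k B)"
    by (rule nn_integral_dominating_Un[OF AB]) measurable
  also have "\<dots> = (\<integral>\<^sup>+b. ennreal (g b) \<partial>dominating k B)"
  proof (rule nn_integral_cong)
    fix b
    assume "b \<in> space (dominating k B)"
    then have b: "b \<in> space (borel_on B)"
      by (simp only: space_dominating)
    \<comment> \<open>Here it matters that \<open>f'\<close> is a PDF for every \<open>b\<close>:
      the block \<open>B\<close> is weighted by its density \<open>g\<close> under \<open>P\<close>,
      whose null sets may differ from those of \<open>P'\<close>.\<close>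
    then have f'b: "is_pdf k A (\<lambda>a. f' a b)" and gb: "0 \<le> g b"
      using f' g by (auto simp: has_conditional_pdf_def has_marginal_pdf_def is_pdf_def)
    have b_ext: "restrict b B = b"
      using b by (simp add: space_PiM PiE_iff extensional_restrict)
    have "(\<integral>\<^sup>+a. ennreal (?h (merge B A (b, a))) \<partial>dominating k A) =
        (\<integral>\<^sup>+a. ennreal (f' a b) * ennreal (g b) \<partial>dominating k A)"
    proof (rule nn_integral_cong)
      fix a
      assume "a \<in> space (dominating k A)"
      then have "a \<in> space (borel_on A)"
        by (simp only: space_dominating)
      then have "restrict a A = a" "0 \<le> f' a b"
        using f'b by (auto simp: space_PiM PiE_iff extensional_restrict is_pdf_def)
      then show "ennreal (?h (merge B A (b, a))) = ennreal (f' a b) * ennreal (g b)"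
        using AB gb b_ext by (simp add: Int_commute ennreal_mult)
    qed
    also have "\<dots> = (\<integral>\<^sup>+a. ennreal (f' a b) \<partial>dominating k A) * ennreal (g b)"
      using f'b by (intro nn_integral_multc) (auto simp: is_pdf_def intro!: measurable_dominating)
    finally show "(\<integral>\<^sup>+a. ennreal (?h (merge B A (b, a))) \<partial>dominating k A) = ennreal (g b)"
      using f'b by (simp add: is_pdf_def)
  qed
  also have "\<dots> = 1"
    using g by (simp add: has_marginal_pdf_def is_pdf_def)
  finally show "(\<integral>\<^sup>+x. ennreal (f' (subvec A x) (subvec B x) / f (subvec A x) (subvec B x)) \<partial>P) \<le> 1" .
qed

section \<open>The composite likelihood as one weighted product\<close>

definition component_index :: "('d::finite set + 'd set \<times> 'd set) set" where
  "component_index = subset_index <+> pair_index"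

definition component ::
    "('d::finite set \<Rightarrow> ('d \<Rightarrow> real) \<Rightarrow> 't \<Rightarrow> real) \<Rightarrow>
     ('d set \<times> 'd set \<Rightarrow> ('d \<Rightarrow> real) \<Rightarrow> ('d \<Rightarrow> real) \<Rightarrow> 't \<Rightarrow> real) \<Rightarrow>
     real ^ 'd \<Rightarrow> 't \<Rightarrow> 'd set + 'd set \<times> 'd set \<Rightarrow> real" where
  "component pm pc x \<theta> =
     case_sum (\<lambda>S. pm S (subvec S x) \<theta>) (\<lambda>T. pc T (subvec (fst T) x) (subvec (snd T) x) \<theta>)"

definition component_weight ::
    "('d::finite set \<Rightarrow> real) \<Rightarrow> ('d set \<times> 'd set \<Rightarrow> real) \<Rightarrow> 'd set + 'd set \<times> 'd set \<Rightarrow> real" where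
  "component_weight \<alpha> \<beta> =
     case_sum (\<lambda>S. \<alpha> S / total_weight \<alpha> \<beta>) (\<lambda>T. \<beta> T / total_weight \<alpha> \<beta>)"

lemma finite_component_index: "finite component_index"
  by simp

text \<open>The sum type merges marginal and conditional factors into one family, so that AM-GM
  applies once, to weights with total 1.\<close>

lemma composite_likelihood_eq_prod:
  "composite_likelihood \<alpha> \<beta> pm pc x \<theta> =
     (\<Prod>i\<in>component_index. rpow (component pm pc x \<theta> i) (component_weight \<alpha> \<beta> i))"
  by (simp add: composite_likelihood_def component_index_def component_def component_weight_def prod.Plus)

lemma sum_component_weight:
  assumes "total_weight \<alpha> \<beta> \<noteq> 0"
  shows "sum (component_weight \<alpha> \<beta>) component_index = 1"
proof -
  have "sum (component_weight \<alpha> \<beta>) component_index =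
      (sum \<alpha> subset_index + sum \<beta> pair_index) / total_weight \<alpha> \<beta>"
    by (simp add: component_index_def component_weight_def sum.Plus add_divide_distrib sum_divide_distrib)
  also have "\<dots> = total_weight \<alpha> \<beta> / total_weight \<alpha> \<beta>"
    by (simp only: total_weight_def)
  finally show ?thesis
    using assms by simp
qed

lemma composite_likelihood_nonneg: "0 \<le> composite_likelihood \<alpha> \<beta> pm pc x \<theta>"
  by (simp add: composite_likelihood_eq_prod prod_nonneg rpow_nonneg)

section \<open>Likelihood ratios for a single observation\<close>

locale composite_model =
  fixes k :: pdf_kind and \<X> :: "(real ^ 'd) set" and \<Theta> :: "'t set"
    and P :: "'t \<Rightarrow> (real ^ 'd) measure"
    and pm :: "'d set \<Rightarrow> ('d \<Rightarrow> real) \<Rightarrow> 't \<Rightarrow> real"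
    and pc :: "'d set \<times> 'd set \<Rightarrow> ('d \<Rightarrow> real) \<Rightarrow> ('d \<Rightarrow> real) \<Rightarrow> 't \<Rightarrow> real"
    and \<alpha> :: "'d set \<Rightarrow> real" and \<beta> :: "'d set \<times> 'd set \<Rightarrow> real"
  assumes sets_P: "\<theta> \<in> \<Theta> \<Longrightarrow> sets (P \<theta>) = sets (restrict_space borel \<X>)"
    and marginal: "\<theta> \<in> \<Theta> \<Longrightarrow> S \<in> subset_index \<Longrightarrow> has_marginal_pdf k (P \<theta>) S (\<lambda>x. pm S x \<theta>)"
    and conditional: "\<theta> \<in> \<Theta> \<Longrightarrow> (A, B) \<in> pair_index \<Longrightarrow>
        has_conditional_pdf k (P \<theta>) A B (\<lambda>b. pm B b \<theta>) (\<lambda>a b. pc (A, B) a b \<theta>)"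
    and weights_nonneg: "S \<in> subset_index \<Longrightarrow> 0 \<le> \<alpha> S" "T \<in> pair_index \<Longrightarrow> 0 \<le> \<beta> T"
    and weight_pos: "total_weight \<alpha> \<beta> > 0"
begin

abbreviation "L \<equiv> composite_likelihood \<alpha> \<beta> pm pc"

lemma subvec_measurable_P: "\<theta> \<in> \<Theta> \<Longrightarrow> subvec S \<in> measurable (P \<theta>) (borel_on S)"
  by (rule subvec_measurable[OF sets_P])

lemma component_weight_nonneg: "i \<in> component_index \<Longrightarrow> 0 \<le> component_weight \<alpha> \<beta> i"
  using weights_nonneg weight_pos by (auto simp: component_index_def component_weight_def)

lemma component_nonneg:
  assumes "\<theta> \<in> \<Theta>" "i \<in> component_index"
  shows "0 \<le> component pm pc x \<theta> i"
proof (cases i)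
  case (Inl S)
  then have "S \<in> subset_index"
    using assms by (auto simp: component_index_def)
  from marginal[OF assms(1) this] show ?thesis
    using subvec_in_space by (auto simp: Inl component_def has_marginal_pdf_def is_pdf_def)
next
  case (Inr T)
  obtain A B where T: "T = (A, B)" "(A, B) \<in> pair_index"
    using assms Inr by (cases T) (auto simp: component_index_def)
  from conditional[OF assms(1) T(2)] show ?thesis
    using subvec_in_space[of B x] subvec_in_space[of A x]
    by (auto simp: Inr T component_def has_conditional_pdf_def is_pdf_def)
qed

lemma component_measurable:
  assumes "\<theta> \<in> \<Theta>" "i \<in> component_index"
  shows "(\<lambda>x. component pm pc x \<theta> i) \<in> borel_measurable (restrict_space borel \<X>)"
proof (cases i)
  case (Inl S)
  then have "S \<in> subset_index"
    using assms by (auto simp: component_index_def)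
  from marginal[OF assms(1) this] have "(\<lambda>z. pm S z \<theta>) \<in> borel_measurable (borel_on S)"
    by (simp add: has_marginal_pdf_def is_pdf_def)
  from measurable_compose[OF subvec_measurable[OF refl] this] show ?thesis
    by (simp add: Inl component_def)
next
  case (Inr T)
  obtain A B where T: "T = (A, B)" "(A, B) \<in> pair_index"
    using assms Inr by (cases T) (auto simp: component_index_def)
  from conditional[OF assms(1) T(2)]
  have "(\<lambda>z. pc (A, B) (restrict z A) (restrict z B) \<theta>) \<in> borel_measurable (borel_on (A \<union> B))"
    by (simp add: has_conditional_pdf_def)
  from measurable_compose[OF subvec_measurable[OF refl] this] show ?thesis
    by (simp add: Inr T component_def restrict_subvec)
qed

lemma likelihood_measurable:
  assumes "\<theta> \<in> \<Theta>"
  shows "(\<lambda>x. L x \<theta>) \<in> borel_measurable (restrict_space borel \<X>)"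
  unfolding composite_likelihood_eq_prod
  by (intro borel_measurable_prod borel_measurable_rpow component_measurable assms)

lemma
  assumes \<theta>: "\<theta> \<in> \<Theta>" and i: "i \<in> component_index"
  shows AE_component_pos: "AE x in P \<theta>. 0 < component pm pc x \<theta> i"
    and nn_integral_component_ratio_le:
      "\<theta>' \<in> \<Theta> \<Longrightarrow> (\<integral>\<^sup>+x. ennreal (component pm pc x \<theta>' i / component pm pc x \<theta> i) \<partial>P \<theta>) \<le> 1"
proof -
  note subvec = subvec_measurable_P[OF \<theta>]
  have "(AE x in P \<theta>. 0 < component pm pc x \<theta> i) \<and>
    (\<theta>' \<in> \<Theta> \<longrightarrow> (\<integral>\<^sup>+x. ennreal (component pm pc x \<theta>' i / component pm pc x \<theta> i) \<partial>P \<theta>) \<le> 1)"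
  proof (cases i)
    case (Inl S)
    then have S: "S \<in> subset_index"
      using i by (auto simp: component_index_def)
    have "(\<integral>\<^sup>+x. ennreal (pm S (subvec S x) \<theta>' / pm S (subvec S x) \<theta>) \<partial>P \<theta>) \<le> 1" if "\<theta>' \<in> \<Theta>"
    proof -
      have "(\<lambda>z. pm S z \<theta>') \<in> borel_measurable (borel_on S)"
        "(\<integral>\<^sup>+z. ennreal (pm S z \<theta>') \<partial>dominating k S) = 1"
        using marginal[OF that S] by (auto simp: has_marginal_pdf_def is_pdf_def)
      with nn_integral_marginal_ratio_le[OF subvec marginal[OF \<theta> S], of "\<lambda>z. pm S z \<theta>'"] show ?thesis
        by simp
    qed
    then show ?thesis
      using AE_marginal_pdf_pos[OF subvec marginal[OF \<theta> S]] by (simp add: Inl component_def)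
  next
    case (Inr T)
    obtain A B where T: "T = (A, B)" "(A, B) \<in> pair_index"
      using i Inr by (cases T) (auto simp: component_index_def)
    \<comment> \<open>A conditioning block is non-empty, so its density is one of the marginals of
      the model.\<close>
    have AB: "A \<inter> B = {}" and B: "B \<in> subset_index"
      using T by (auto simp: pair_index_def subset_index_def)
    note cond = subvec AB marginal[OF \<theta> B] conditional[OF \<theta> T(2)]
    show ?thesis
      using AE_conditional_pdf_pos[OF cond] nn_integral_conditional_ratio_le[OF cond conditional[OF _ T(2)], of \<theta>']
      by (simp add: Inr T component_def)
  qed
  then show "AE x in P \<theta>. 0 < component pm pc x \<theta> i"
    "\<theta>' \<in> \<Theta> \<Longrightarrow> (\<integral>\<^sup>+x. ennreal (component pm pc x \<theta>' i / component pm pc x \<theta> i) \<partial>P \<theta>) \<le> 1"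
    by auto
qed

text \<open>Finitely many almost sure events are intersected. This later rules out a zero
  denominator in the ratio against the true parameter.\<close>

lemma AE_likelihood_pos:
  assumes "\<theta> \<in> \<Theta>"
  shows "AE x in P \<theta>. 0 < L x \<theta>"
proof -
  have "AE x in P \<theta>. \<forall>i\<in>component_index. 0 < component pm pc x \<theta> i"
    using AE_component_pos[OF assms] by (intro AE_finite_allI) (auto simp: finite_component_index)
  then show ?thesis
    by eventually_elim (auto simp: composite_likelihood_eq_prod intro!: prod_pos rpow_pos)
qed

text \<open>The components may be dependent, so the expectation of their product need not factor.
  Pointwise AM-GM trades the product for a weighted sum, and the expectation of a sum
  splits.\<close>

lemma nn_integral_likelihood_ratio_le:
  assumes \<theta>: "\<theta> \<in> \<Theta>" and \<theta>': "\<theta>' \<in> \<Theta>"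
  shows "(\<integral>\<^sup>+x. ennreal (L x \<theta>' / L x \<theta>) \<partial>P \<theta>) \<le> 1"
proof -
  let ?r = "\<lambda>x i. component pm pc x \<theta>' i / component pm pc x \<theta> i"
  let ?w = "component_weight \<alpha> \<beta>"
  have r_nonneg: "0 \<le> ?r x i" if "i \<in> component_index" for x i
    using component_nonneg[OF \<theta> that] component_nonneg[OF \<theta>' that] by simp
  have r_meas: "(\<lambda>x. ennreal (?r x i)) \<in> borel_measurable (P \<theta>)" if "i \<in> component_index" for i
    using component_measurable[OF \<theta> that] component_measurable[OF \<theta>' that]
    by (simp add: measurable_cong_sets[OF sets_P[OF \<theta>] refl])
  have "ennreal (L x \<theta>' / L x \<theta>) \<le> (\<Sum>i\<in>component_index. ennreal (?w i) * ennreal (?r x i))" for x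
  proof -
    \<comment> \<open>The identity survives vanishing denominators: with \<open>y / 0 = 0\<close>
      and \<open>0 powr a = 0\<close>, division commutes with \<open>rpow\<close> and with finite
      products.\<close>
    have "L x \<theta>' / L x \<theta> = (\<Prod>i\<in>component_index. rpow (?r x i) (?w i))"
      by (simp add: composite_likelihood_eq_prod rpow_divide prod_dividef)
    also have "\<dots> \<le> (\<Sum>i\<in>component_index. ?w i * ?r x i)"
      using weight_pos r_nonneg component_weight_nonneg
      by (intro prod_rpow_le_sum finite_component_index sum_component_weight) auto
    finally have "ennreal (L x \<theta>' / L x \<theta>) \<le> ennreal (\<Sum>i\<in>component_index. ?w i * ?r x i)"
      by (rule ennreal_leI)
    also have "\<dots> = (\<Sum>i\<in>component_index. ennreal (?w i * ?r x i))"
      using r_nonneg component_weight_nonneg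
      by (intro sum_ennreal[symmetric] mult_nonneg_nonneg) auto
    also have "\<dots> = (\<Sum>i\<in>component_index. ennreal (?w i) * ennreal (?r x i))"
      using r_nonneg component_weight_nonneg by (intro sum.cong refl ennreal_mult) auto
    finally show ?thesis .
  qed
  then have "(\<integral>\<^sup>+x. ennreal (L x \<theta>' / L x \<theta>) \<partial>P \<theta>) \<le>
      (\<integral>\<^sup>+x. (\<Sum>i\<in>component_index. ennreal (?w i) * ennreal (?r x i)) \<partial>P \<theta>)"
    by (rule nn_integral_mono)
  also have "\<dots> = (\<Sum>i\<in>component_index. ennreal (?w i) * (\<integral>\<^sup>+x. ennreal (?r x i) \<partial>P \<theta>))"
    using r_meas by (simp add: nn_integral_sum nn_integral_cmult)
  also have "\<dots> \<le> (\<Sum>i\<in>component_index. ennreal (?w i) * 1)"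
    using nn_integral_component_ratio_le[OF \<theta> _ \<theta>'] by (intro sum_mono mult_left_mono) auto
  also have "\<dots> = ennreal (sum ?w component_index)"
    using component_weight_nonneg by (simp add: sum_ennreal)
  also have "\<dots> = 1"
    using weight_pos by (simp add: sum_component_weight)
  finally show ?thesis .
qed

end

section \<open>Stopped processes and Ville's maximal inequality\<close>

text \<open>\<open>Y\<close> frozen at its first value of at least \<open>c\<close>. The recursion
  needs no explicit stopping time.\<close>

primrec stopped :: "ennreal \<Rightarrow> (nat \<Rightarrow> 'x \<Rightarrow> ennreal) \<Rightarrow> nat \<Rightarrow> 'x \<Rightarrow> ennreal" where
  "stopped c Y 0 x = Y 0 x"
| "stopped c Y (Suc n) x = (if c \<le> stopped c Y n x then stopped c Y n x else Y (Suc n) x)"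

lemma stopped_eq: "\<not> c \<le> stopped c Y n x \<Longrightarrow> stopped c Y n x = Y n x"
  by (cases n) auto

text \<open>Freezing remembers that the level was reached, so an event about the running maximum
  becomes an event about one time.\<close>

lemma le_stopped_iff: "c \<le> stopped c Y n x \<longleftrightarrow> (\<exists>s\<le>n. c \<le> Y s x)"
  by (induction n) (auto simp: le_Suc_eq)

lemma stopped_cong: "(\<And>s. s \<le> n \<Longrightarrow> Y s x = Y s y) \<Longrightarrow> stopped c Y n x = stopped c Y n y"
  by (induction n) auto

lemma borel_measurable_stopped:
  "(\<And>s. s \<le> n \<Longrightarrow> Y s \<in> borel_measurable M) \<Longrightarrow> stopped c Y n \<in> borel_measurable M"
proof (induction n)
  case 0
  then show ?case
    by simp
next
  case (Suc n)
  then have [measurable]: "stopped c Y n \<in> borel_measurable M" "Y (Suc n) \<in> borel_measurable M"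
    by auto
  show ?case
    by simp
qed

lemma measurable_PiM_superset:
  assumes "f \<in> measurable (PiM J M) N" "\<And>x. f (restrict x J) = f x" "J \<subseteq> I"
  shows "f \<in> measurable (PiM I M) N"
proof -
  have "(\<lambda>x. f (restrict x J)) \<in> measurable (PiM I M) N"
    using assms by (intro measurable_compose[OF measurable_restrict_subset]) auto
  then show ?thesis
    using assms by simp
qed

text \<open>The stopped process keeps expectation at most 1: it is constant once frozen, and
  otherwise \<open>step\<close> applies. The supermartingale property is phrased by integrating out
  coordinate \<open>Suc n\<close> with the earlier ones fixed, which Fubini on the product uses
  directly in place of conditional expectations.\<close>

lemma maximal_inequality_PiM:
  fixes Y :: "nat \<Rightarrow> (nat \<Rightarrow> 'x) \<Rightarrow> ennreal"
  assumes P: "prob_space P"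
    and meas: "\<And>n. Y n \<in> borel_measurable (PiM {1..n} (\<lambda>_. P))"
    and adapted: "\<And>n x. Y n (restrict x {1..n}) = Y n x"
    and start: "\<And>x. Y 0 x \<le> 1"
    and step: "\<And>n x. x \<in> space (PiM {1..n} (\<lambda>_. P)) \<Longrightarrow>
        (\<integral>\<^sup>+y. Y (Suc n) (x(Suc n := y)) \<partial>P) \<le> Y n x"
  shows "c * emeasure (PiM {1..n} (\<lambda>_. P)) {x \<in> space (PiM {1..n} (\<lambda>_. P)). \<exists>s\<le>n. c \<le> Y s x} \<le> 1"
proof -
  interpret p: prob_space P by fact
  interpret product_sigma_finite "\<lambda>_::nat. P"
    by standard
  have [measurable]: "Y s \<in> borel_measurable (PiM {1..n} (\<lambda>_. P))" if "s \<le> n" for s n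
    using that by (intro measurable_PiM_superset[where f = "Y s", OF meas adapted]) auto
  have st_meas: "stopped c Y n \<in> borel_measurable (PiM {1..n} (\<lambda>_. P))" for n
    by (rule borel_measurable_stopped) measurable
  have Y_upd: "Y s (x(Suc n := y)) = Y s x" if "s \<le> n" for s n x y
  proof -
    have "restrict (x(Suc n := y)) {1..s} = restrict x {1..s}"
      using that by (auto simp: restrict_def)
    then show ?thesis
      by (metis adapted)
  qed
  have "(\<integral>\<^sup>+x. stopped c Y n x \<partial>PiM {1..n} (\<lambda>_. P)) \<le> 1"
  proof (induction n)
    case 0
    interpret Q: prob_space "PiM {} (\<lambda>_. P) :: (nat \<Rightarrow> 'x) measure"
      by (intro prob_space_PiM P)
    have "(\<integral>\<^sup>+x. Y 0 x \<partial>PiM {} (\<lambda>_. P)) \<le> (\<integral>\<^sup>+x. 1 \<partial>(PiM {} (\<lambda>_. P) :: (nat \<Rightarrow> 'x) measure))"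
      using start by (intro nn_integral_mono) auto
    then show ?case
      using Q.emeasure_space_1 by simp
  next
    case (Suc n)
    have ins: "{1..Suc n} = insert (Suc n) {1..n}"
      by auto
    have "(\<integral>\<^sup>+x. stopped c Y (Suc n) x \<partial>PiM {1..Suc n} (\<lambda>_. P)) =
        (\<integral>\<^sup>+x. \<integral>\<^sup>+y. stopped c Y (Suc n) (x(Suc n := y)) \<partial>P \<partial>PiM {1..n} (\<lambda>_. P))"
      using st_meas[of "Suc n"] unfolding ins by (intro product_nn_integral_insert) (auto simp del: stopped.simps One_nat_def)
    also have "\<dots> \<le> (\<integral>\<^sup>+x. stopped c Y n x \<partial>PiM {1..n} (\<lambda>_. P))"
    proof (rule nn_integral_mono)
      fix x
      assume x: "x \<in> space (PiM {1..n} (\<lambda>_. P))"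
      have st: "stopped c Y n (x(Suc n := y)) = stopped c Y n x" for y
        by (rule stopped_cong) (rule Y_upd)
      show "(\<integral>\<^sup>+y. stopped c Y (Suc n) (x(Suc n := y)) \<partial>P) \<le> stopped c Y n x"
      proof (cases "c \<le> stopped c Y n x")
        case True
        then show ?thesis
          by (simp add: st p.emeasure_space_1)
      next
        case False
        then show ?thesis
          using step[OF x, folded stopped_eq[OF False]] by (simp add: st)
      qed
    qed
    also note Suc
    finally show ?case .
  qed
  moreover have "c * emeasure (PiM {1..n} (\<lambda>_. P)) {x \<in> space (PiM {1..n} (\<lambda>_. P)). \<exists>s\<le>n. c \<le> Y s x} \<le>
      (\<integral>\<^sup>+x. stopped c Y n x \<partial>PiM {1..n} (\<lambda>_. P))"
  proof -
    \<comment> \<open>Markov's inequality at the final time only; \<open>le_stopped_iff\<close>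
      translates back to all times up to \<open>n\<close>.\<close>
    let ?E = "{x \<in> space (PiM {1..n} (\<lambda>_. P)). c \<le> stopped c Y n x}"
    have "?E \<in> sets (PiM {1..n} (\<lambda>_. P))"
      using st_meas by measurable
    then have "c * emeasure (PiM {1..n} (\<lambda>_. P)) ?E = (\<integral>\<^sup>+x. c * indicator ?E x \<partial>PiM {1..n} (\<lambda>_. P))"
      by (simp add: nn_integral_cmult_indicator)
    also have "\<dots> \<le> (\<integral>\<^sup>+x. stopped c Y n x \<partial>PiM {1..n} (\<lambda>_. P))"
      by (intro nn_integral_mono) (auto simp: indicator_def)
    finally show ?thesis
      by (simp only: le_stopped_iff)
  qed
  ultimately show ?thesis
    by (rule order_trans[rotated])
qed

text \<open>By independence the first \<open>n\<close> observations have a product law, so the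
  finite-horizon bound transfers to them. The events for growing \<open>n\<close> increase to the
  event that \<open>c\<close> is ever reached, and the measure is continuous from below.\<close>

lemma (in prob_space) maximal_inequality_iid:
  fixes X :: "nat \<Rightarrow> 'a \<Rightarrow> 'x" and Y :: "nat \<Rightarrow> (nat \<Rightarrow> 'x) \<Rightarrow> ennreal"
  assumes indep: "indep_vars (\<lambda>_. D) X {1..}"
    and X_law: "\<And>i. 1 \<le> i \<Longrightarrow> distr M D (X i) = P"
    and meas: "\<And>n. Y n \<in> borel_measurable (PiM {1..n} (\<lambda>_. D))"
    and adapted: "\<And>n x. Y n (restrict x {1..n}) = Y n x"
    and start: "\<And>x. Y 0 x \<le> 1"
    and step: "\<And>n x. x \<in> space (PiM {1..n} (\<lambda>_. D)) \<Longrightarrow>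
        (\<integral>\<^sup>+y. Y (Suc n) (x(Suc n := y)) \<partial>P) \<le> Y n x"
  shows "{\<omega> \<in> space M. \<exists>n. c \<le> Y n (\<lambda>i. X i \<omega>)} \<in> events"
    and "c * emeasure M {\<omega> \<in> space M. \<exists>n. c \<le> Y n (\<lambda>i. X i \<omega>)} \<le> 1"
proof -
  have X [measurable]: "X i \<in> measurable M D" if "i \<in> {1..}" for i
    using indep that by (auto simp: indep_vars_def2)
  have P: "prob_space P"
    using prob_space_distr[OF X, of 1] by (simp add: X_law)
  have sets_P: "sets P = sets D"
    using X_law[of 1] by auto
  have PiM_P: "sets (PiM {1..n} (\<lambda>_. P)) = sets (PiM {1..n} (\<lambda>_. D))" for n :: nat
    using sets_P by (intro sets_PiM_cong) auto
  have space_P: "space (PiM {1..n} (\<lambda>_. P)) = space (PiM {1..n} (\<lambda>_. D))" for n :: nat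
    by (rule sets_eq_imp_space_eq[OF PiM_P])
  have X_res: "(\<lambda>\<omega>. \<lambda>i\<in>{1..n}. X i \<omega>) \<in> measurable M (PiM {1..n} (\<lambda>_. D))" for n :: nat
    using X by (intro measurable_restrict) auto
  \<comment> \<open>The full sequence is in general not extensional and so lies outside the product
    space; restricting it repairs this without changing \<open>Y n\<close>.\<close>
  have Y_X: "Y n (\<lambda>i. X i \<omega>) = Y n (\<lambda>i\<in>{1..n}. X i \<omega>)" for n \<omega>
    by (rule adapted[symmetric])
  have [measurable]: "(\<lambda>\<omega>. Y n (\<lambda>i. X i \<omega>)) \<in> borel_measurable M" for n
    unfolding Y_X using measurable_compose[OF X_res meas] .
  let ?E = "\<lambda>n. {\<omega> \<in> space M. \<exists>s\<le>n. c \<le> Y s (\<lambda>i. X i \<omega>)}"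
  have E [measurable]: "?E n \<in> events" for n
    by measurable
  have E_Un: "{\<omega> \<in> space M. \<exists>n. c \<le> Y n (\<lambda>i. X i \<omega>)} = (\<Union>n. ?E n)"
    by auto
  show "{\<omega> \<in> space M. \<exists>n. c \<le> Y n (\<lambda>i. X i \<omega>)} \<in> events"
    by measurable
  have E_le: "c * emeasure M (?E n) \<le> 1" if n: "1 \<le> n" for n
  proof -
    let ?Q = "PiM {1..n} (\<lambda>_. D)"
    have "indep_vars (\<lambda>_. D) X {1..n}"
      using indep by (rule indep_vars_subset) auto
    then have "distr M ?Q (\<lambda>\<omega>. \<lambda>i\<in>{1..n}. X i \<omega>) = PiM {1..n} (\<lambda>i. distr M D (X i))"
      using n X by (subst (asm) indep_vars_iff_distr_eq_PiM') auto
    also have "\<dots> = PiM {1..n} (\<lambda>_. P)"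
      by (intro PiM_cong) (auto simp: X_law)
    finally have law: "distr M ?Q (\<lambda>\<omega>. \<lambda>i\<in>{1..n}. X i \<omega>) = PiM {1..n} (\<lambda>_. P)" .
    let ?A = "{x \<in> space ?Q. \<exists>s\<le>n. c \<le> Y s x}"
    have [measurable]: "Y s \<in> borel_measurable ?Q" if "s \<le> n" for s
      using that by (intro measurable_PiM_superset[where f = "Y s", OF meas adapted]) auto
    have A: "?A \<in> sets ?Q"
      by measurable
    have "?E n = (\<lambda>\<omega>. \<lambda>i\<in>{1..n}. X i \<omega>) -` ?A \<inter> space M"
    proof -
      have "Y s (\<lambda>i\<in>{1..n}. X i \<omega>) = Y s (\<lambda>i. X i \<omega>)" if "s \<le> n" for s \<omega>
        using adapted[of s "\<lambda>i\<in>{1..n}. X i \<omega>"] adapted[of s "\<lambda>i. X i \<omega>"] that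
        by (simp add: Int_absorb1)
      then show ?thesis
        using measurable_space[OF X_res[of n]] by auto
    qed
    then have "emeasure M (?E n) = emeasure (PiM {1..n} (\<lambda>_. P)) ?A"
      unfolding law[symmetric] by (simp only: emeasure_distr[OF X_res A])
    moreover have "Y n \<in> borel_measurable (PiM {1..n} (\<lambda>_. P))" for n
      using meas measurable_cong_sets[OF PiM_P refl] by blast
    then have "c * emeasure (PiM {1..n} (\<lambda>_. P)) {x \<in> space (PiM {1..n} (\<lambda>_. P)). \<exists>s\<le>n. c \<le> Y s x} \<le> 1"
      using adapted start step by (intro maximal_inequality_PiM P) (auto simp only: space_P)
    ultimately show ?thesis
      by (simp only: space_P)
  qed
  have "c * emeasure M (\<Union>n. ?E n) = (SUP n. c * emeasure M (?E n))"
    using E by (subst SUP_emeasure_incseq[symmetric])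
      (auto simp: incseq_def SUP_mult_left_ennreal intro: order_trans)
  also have "\<dots> \<le> 1"
  proof (rule SUP_least)
    fix n
    \<comment> \<open>\<open>E_le\<close> requires a non-empty set of indices; enlarging the horizon
      by one also covers \<open>n = 0\<close>.\<close>
    have "c * emeasure M (?E n) \<le> c * emeasure M (?E (Suc n))"
      using E by (intro mult_left_mono emeasure_mono) (auto intro: le_SucI)
    also have "\<dots> \<le> 1"
      by (rule E_le) simp
    finally show "c * emeasure M (?E n) \<le> 1" .
  qed
  finally show "c * emeasure M {\<omega> \<in> space M. \<exists>n. c \<le> Y n (\<lambda>i. X i \<omega>)} \<le> 1"
    unfolding E_Un .
qed

section \<open>Plug-in likelihood, maximal likelihood and the p-statistic\<close>

text \<open>Non-anticipation: the estimators in the first \<open>Suc n\<close> factors see only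
  coordinates up to \<open>n\<close>, so the new value \<open>y\<close> enters the last factor
  alone, and only as its observation.\<close>

lemma plugin_likelihood_Suc:
  "plugin_likelihood L est1 (Suc n) (x(Suc n := y)) =
     plugin_likelihood L est1 n x * L y (est1 n (restrict x {1..n}))"
proof -
  have *: "restrict (x(Suc n := y)) {1..m} = restrict x {1..m}" if "m \<le> n" for m
    using that by (auto simp: restrict_def)
  have "plugin_likelihood L est1 n (x(Suc n := y)) = plugin_likelihood L est1 n x"
    unfolding plugin_likelihood_def by (intro prod.cong) (auto simp: * simp del: One_nat_def)
  then show ?thesis
    using *[of n] by (simp add: plugin_likelihood_def)
qed

lemma plugin_likelihood_restrict:
  "m \<le> n \<Longrightarrow> plugin_likelihood L est1 m (restrict x {1..n}) = plugin_likelihood L est1 m x"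
  unfolding plugin_likelihood_def by (intro prod.cong) (auto simp: Int_absorb1 simp del: One_nat_def)

lemma max_likelihood_restrict:
  "max_likelihood L est0 n (restrict x {1..n}) = max_likelihood L est0 n x"
  unfolding max_likelihood_def by (intro prod.cong) (auto simp del: One_nat_def)

text \<open>Replacing the maximal likelihood by the smaller likelihood of \<theta> can only enlarge
  the ratio. Positivity passes from \<theta> to the maximum, so the statistic is a genuine real
  quotient that can be inverted.\<close>

lemma p_stat_le_imp_ratio_ge:
  assumes L: "\<And>x \<theta>. 0 \<le> L x \<theta>" and a: "0 < a"
    and pos: "0 < (\<Prod>i=1..n. L (x i) \<theta>)"
    and max: "(\<Prod>i=1..n. L (x i) \<theta>) \<le> max_likelihood L est0 n x"
    and le: "p_stat L est1 est0 n x \<le> ennreal a"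
  shows "ennreal (1 / a) \<le> ennreal (plugin_likelihood L est1 n x / (\<Prod>i=1..n. L (x i) \<theta>))"
proof -
  let ?p = "plugin_likelihood L est1 n x" and ?m = "max_likelihood L est0 n x"
  have p: "0 \<le> ?p" and m: "0 < ?m"
    using L pos max by (auto simp: plugin_likelihood_def intro: prod_nonneg)
  have stat: "running_stat L est1 est0 n x = ennreal (?p / ?m)"
    using p m by (simp add: running_stat_def divide_ennreal)
  \<comment> \<open>A vanishing plug-in likelihood would make the p-statistic infinite,
    contradicting its finite bound.\<close>
  have "?p \<noteq> 0"
  proof
    assume "?p = 0"
    then show False
      using le by (simp add: p_stat_def stat top_unique)
  qed
  with p have "0 < ?p"
    by simp
  with m have "p_stat L est1 est0 n x = ennreal (?m / ?p)"
    by (simp add: p_stat_def stat divide_ennreal flip: ennreal_1)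
  with le a have "?m / ?p \<le> a"
    by simp
  then have "1 / a \<le> ?p / ?m"
    using \<open>0 < ?p\<close> m a by (simp add: field_simps)
  also have "\<dots> \<le> ?p / (\<Prod>i=1..n. L (x i) \<theta>)"
    using p pos max by (intro divide_left_mono) auto
  finally show ?thesis
    by (rule ennreal_leI)
qed

lemma p_stat_measurable:
  assumes [measurable]: "\<And>i. 1 \<le> i \<Longrightarrow> X i \<in> measurable F D"
    and meas: "\<And>n. 1 \<le> n \<Longrightarrow> plugin_likelihood L est1 n \<in> borel_measurable (PiM {1..n} (\<lambda>_. D))"
      "\<And>n. 1 \<le> n \<Longrightarrow> max_likelihood L est0 n \<in> borel_measurable (PiM {1..n} (\<lambda>_. D))"
  shows "(\<lambda>\<omega>. p_stat L est1 est0 n (\<lambda>i. X i \<omega>)) \<in> borel_measurable F"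
proof (cases "n = 0")
  \<comment> \<open>Index 0 must be covered because \<open>N\<close> is later composed as a map into
    all naturals; there both products are empty and the statistic is constant.\<close>
  case True
  then show ?thesis
    by (simp add: p_stat_def running_stat_def plugin_likelihood_def max_likelihood_def)
next
  case False
  then have n: "1 \<le> n"
    by simp
  have X_res: "(\<lambda>\<omega>. \<lambda>i\<in>{1..n}. X i \<omega>) \<in> measurable F (PiM {1..n} (\<lambda>_. D))"
    by (intro measurable_restrict) simp
  have [measurable]: "(\<lambda>\<omega>. plugin_likelihood L est1 n (\<lambda>i. X i \<omega>)) \<in> borel_measurable F"
    using measurable_compose[OF X_res meas(1)[OF n]] by (simp only: plugin_likelihood_restrict order_refl)
  have [measurable]: "(\<lambda>\<omega>. max_likelihood L est0 n (\<lambda>i. X i \<omega>)) \<in> borel_measurable F"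
    using measurable_compose[OF X_res meas(2)[OF n]] by (simp only: max_likelihood_restrict)
  show ?thesis
    unfolding p_stat_def running_stat_def by measurable
qed

section \<open>Validity of both p-values at an arbitrary random time\<close>

theorem proposition4:
  fixes k :: pdf_kind
    and \<X> :: "(real ^ 'd) set" and \<Theta> \<Theta>0 :: "(real ^ 'q) set"
    and P :: "real ^ 'q \<Rightarrow> (real ^ 'd) measure"
    and pm :: "'d set \<Rightarrow> ('d \<Rightarrow> real) \<Rightarrow> real ^ 'q \<Rightarrow> real"
    and pc :: "'d set \<times> 'd set \<Rightarrow> ('d \<Rightarrow> real) \<Rightarrow> ('d \<Rightarrow> real) \<Rightarrow> real ^ 'q \<Rightarrow> real"
    and \<alpha> :: "'d set \<Rightarrow> real" and \<beta> :: "'d set \<times> 'd set \<Rightarrow> real"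
    and F :: "'w measure" and Pr :: "real ^ 'q \<Rightarrow> 'w measure"
    and X :: "nat \<Rightarrow> 'w \<Rightarrow> real ^ 'd"
    and est1 est0 :: "nat \<Rightarrow> (nat \<Rightarrow> real ^ 'd) \<Rightarrow> real ^ 'q"
    and N :: "'w \<Rightarrow> nat"
  defines "D \<equiv> restrict_space borel \<X>"
    and "L \<equiv> composite_likelihood \<alpha> \<beta> pm pc"
  assumes null: "\<Theta>0 \<subseteq> \<Theta>"
    and law: "\<And>\<theta>. \<theta> \<in> \<Theta> \<Longrightarrow> prob_space (P \<theta>) \<and> sets (P \<theta>) = sets D"
    and marginal: "\<And>\<theta> S. \<theta> \<in> \<Theta> \<Longrightarrow> S \<in> subset_index \<Longrightarrow>
        has_marginal_pdf k (P \<theta>) S (\<lambda>x. pm S x \<theta>)"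
    and conditional: "\<And>\<theta> A B. \<theta> \<in> \<Theta> \<Longrightarrow> (A, B) \<in> pair_index \<Longrightarrow>
        has_conditional_pdf k (P \<theta>) A B (\<lambda>b. pm B b \<theta>) (\<lambda>a b. pc (A, B) a b \<theta>)"
    and weights_nonneg: "\<And>S. S \<in> subset_index \<Longrightarrow> 0 \<le> \<alpha> S"
        "\<And>T. T \<in> pair_index \<Longrightarrow> 0 \<le> \<beta> T"
    and weight_pos: "total_weight \<alpha> \<beta> > 0"
    and Pr: "\<And>\<theta>. \<theta> \<in> \<Theta> \<Longrightarrow> prob_space (Pr \<theta>) \<and> sets (Pr \<theta>) = sets F"
    and X_meas: "\<And>i. i \<ge> 1 \<Longrightarrow> X i \<in> measurable F D"
    and X_indep: "\<And>\<theta>. \<theta> \<in> \<Theta> \<Longrightarrow> prob_space.indep_vars (Pr \<theta>) (\<lambda>_. D) X {1..}"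
    and X_law: "\<And>\<theta> i. \<theta> \<in> \<Theta> \<Longrightarrow> i \<ge> 1 \<Longrightarrow> distr (Pr \<theta>) D (X i) = P \<theta>"
    and est1: "\<And>n. est1 n \<in> measurable (PiM {1..n} (\<lambda>_. D)) (restrict_space borel \<Theta>)"
    and est0: "\<And>n. n \<ge> 1 \<Longrightarrow>
        est0 n \<in> measurable (PiM {1..n} (\<lambda>_. D)) (restrict_space borel \<Theta>0)"
    and est0_arg_max: "\<And>n x. n \<ge> 1 \<Longrightarrow> x \<in> space (PiM {1..n} (\<lambda>_. D)) \<Longrightarrow>
        is_arg_max (\<lambda>\<theta>. \<Prod>i=1..n. L (x i) \<theta>) (\<lambda>\<theta>. \<theta> \<in> \<Theta>0) (est0 n x)"
    and likelihoods_meas: "\<And>n. n \<ge> 1 \<Longrightarrow>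
          plugin_likelihood L est1 n \<in> borel_measurable (PiM {1..n} (\<lambda>_. D))"
        "\<And>n. n \<ge> 1 \<Longrightarrow>
          max_likelihood L est0 n \<in> borel_measurable (PiM {1..n} (\<lambda>_. D))"
    and N: "N \<in> measurable F (count_space UNIV)" "\<And>\<omega>. \<omega> \<in> space F \<Longrightarrow> N \<omega> \<ge> 1"
  shows "valid_p_value F Pr \<Theta>0 (\<lambda>\<omega>. p_stat L est1 est0 (N \<omega>) (\<lambda>i. X i \<omega>))
       \<and> valid_p_value F Pr \<Theta>0 (\<lambda>\<omega>. p_stat_min L est1 est0 (N \<omega>) (\<lambda>i. X i \<omega>))"
proof -
  interpret model: composite_model k \<X> \<Theta> P pm pc \<alpha> \<beta>
    using law marginal conditional weights_nonneg weight_pos by unfold_locales (auto simp: D_def)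
  have L_nonneg: "0 \<le> L x \<theta>" for x \<theta>
    unfolding L_def by (rule composite_likelihood_nonneg)
  \<comment> \<open>One event for all times at once: for every \<open>N\<close> it contains the
    rejection events of both p-values at level \<open>a\<close>.\<close>
  define E where "E a = {\<omega> \<in> space F. \<exists>n\<ge>1. p_stat L est1 est0 n (\<lambda>i. X i \<omega>) \<le> ennreal a}" for a
  note p_meas [measurable] = p_stat_measurable[OF X_meas likelihoods_meas]
  have E_meas: "E a \<in> sets F" for a
    unfolding E_def by measurable
  have E_pos: "emeasure (Pr \<theta>) (E a) \<le> ennreal a" if \<theta>0: "\<theta> \<in> \<Theta>0" and a: "0 < a" for \<theta> a
  proof -
    have \<theta>: "\<theta> \<in> \<Theta>"
      using null \<theta>0 by blast
    interpret Pr: prob_space "Pr \<theta>"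
      using Pr[OF \<theta>] by blast
    have sets_Pr: "sets (Pr \<theta>) = sets F"
      using Pr[OF \<theta>] by blast
    have space_Pr: "space (Pr \<theta>) = space F"
      by (rule sets_eq_imp_space_eq[OF sets_Pr])
    have sets_P\<theta>: "sets (P \<theta>) = sets D"
      using law[OF \<theta>] by blast
    have L_meas: "(\<lambda>x. L x \<theta>') \<in> borel_measurable D" if "\<theta>' \<in> \<Theta>" for \<theta>'
      using model.likelihood_measurable[OF that] by (simp add: L_def D_def)
    \<comment> \<open>The fixed \<theta> replaces the maximiser in the denominator. The maximiser
      changes with \<open>n\<close>, which would destroy the one-step product structure.\<close>
    define Y where "Y n x = ennreal (plugin_likelihood L est1 n x / (\<Prod>i=1..n. L (x i) \<theta>))" for n x
    have Y_restrict: "Y n (restrict x {1..n}) = Y n x" for n x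
    proof -
      have "(\<Prod>i=1..n. L (restrict x {1..n} i) \<theta>) = (\<Prod>i=1..n. L (x i) \<theta>)"
        by (intro prod.cong) auto
      then show ?thesis
        by (simp only: Y_def plugin_likelihood_restrict order_refl)
    qed
    have Y_meas: "Y n \<in> borel_measurable (PiM {1..n} (\<lambda>_. D))" for n
    proof (cases "n = 0")
      case True
      have "Y 0 = (\<lambda>_. 1)"
        by (simp add: Y_def plugin_likelihood_def fun_eq_iff)
      with True show ?thesis
        by simp
    next
      case False
      then have [measurable]: "plugin_likelihood L est1 n \<in> borel_measurable (PiM {1..n} (\<lambda>_. D))"
        by (intro likelihoods_meas) simp
      have [measurable]: "(\<lambda>x. \<Prod>i=1..n. L (x i) \<theta>) \<in> borel_measurable (PiM {1..n} (\<lambda>_. D))"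
        by (intro borel_measurable_prod measurable_compose[OF _ L_meas[OF \<theta>]] measurable_component_singleton)
      show ?thesis
        unfolding Y_def by measurable
    qed
    have Y_step: "(\<integral>\<^sup>+y. Y (Suc n) (x(Suc n := y)) \<partial>P \<theta>) \<le> Y n x"
      if x: "x \<in> space (PiM {1..n} (\<lambda>_. D))" for n x
    proof -
      \<comment> \<open>The past determines this estimate, so it is constant in the integral over
        the new observation \<open>y\<close>, and the one-observation bound applies to it.\<close>
      define \<theta>' where "\<theta>' = est1 n (restrict x {1..n})"
      have "restrict x {1..n} = x"
        using x by (simp add: space_PiM PiE_restrict)
      then have \<theta>': "\<theta>' \<in> \<Theta>"
        using measurable_space[OF est1 x] by (simp add: \<theta>'_def space_restrict_space)
      have "Y (Suc n) (x(Suc n := y)) = Y n x * ennreal (L y \<theta>' / L y \<theta>)" for y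
      proof -
        have "(\<Prod>i=1..n. L ((x(Suc n := y)) i) \<theta>) = (\<Prod>i=1..n. L (x i) \<theta>)"
          by (intro prod.cong) auto
        then have "(\<Prod>i=1..Suc n. L ((x(Suc n := y)) i) \<theta>) = (\<Prod>i=1..n. L (x i) \<theta>) * L y \<theta>"
          by simp
        then have "Y (Suc n) (x(Suc n := y)) =
            ennreal (plugin_likelihood L est1 n x / (\<Prod>i=1..n. L (x i) \<theta>) * (L y \<theta>' / L y \<theta>))"
          unfolding Y_def plugin_likelihood_Suc \<theta>'_def by (simp only: times_divide_times_eq)
        also have "\<dots> = Y n x * ennreal (L y \<theta>' / L y \<theta>)"
          unfolding Y_def using L_nonneg by (intro ennreal_mult'') simp
        finally show ?thesis .
      qed
      then have "(\<integral>\<^sup>+y. Y (Suc n) (x(Suc n := y)) \<partial>P \<theta>) =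
          Y n x * (\<integral>\<^sup>+y. ennreal (L y \<theta>' / L y \<theta>) \<partial>P \<theta>)"
        using L_meas[OF \<theta>] L_meas[OF \<theta>'] by (simp add: nn_integral_cmult measurable_cong_sets[OF sets_P\<theta> refl])
      also have "\<dots> \<le> Y n x * 1"
        using model.nn_integral_likelihood_ratio_le[OF \<theta> \<theta>'] by (intro mult_left_mono) (auto simp: L_def)
      finally show ?thesis
        by simp
    qed
    let ?V = "{\<omega> \<in> space (Pr \<theta>). \<exists>n. ennreal (1 / a) \<le> Y n (\<lambda>i. X i \<omega>)}"
    have Y_0: "Y 0 x \<le> 1" for x
      by (simp add: Y_def plugin_likelihood_def)
    note V = Pr.maximal_inequality_iid[OF X_indep[OF \<theta>] X_law[OF \<theta>] Y_meas Y_restrict Y_0 Y_step, of "ennreal (1 / a)"]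
    have "AE \<omega> in Pr \<theta>. 0 < L (X i \<omega>) \<theta>" if i: "1 \<le> i" for i
    proof -
      have "X i \<in> measurable (Pr \<theta>) D"
        using X_meas[OF i] by (simp add: measurable_cong_sets[OF sets_Pr refl])
      moreover have "AE x in distr (Pr \<theta>) D (X i). 0 < L x \<theta>"
        using model.AE_likelihood_pos[OF \<theta>] unfolding X_law[OF \<theta> i] L_def .
      ultimately show ?thesis
        by (rule AE_distrD)
    qed
    then have "AE \<omega> in Pr \<theta>. \<forall>i\<in>{1..}. 0 < L (X i \<omega>) \<theta>"
      by (subst AE_ball_countable) auto
    \<comment> \<open>Only almost sure: where the likelihood of \<theta> vanishes, the quotient
      \<open>Y\<close> is 0 by convention.\<close>
    then have "AE \<omega> in Pr \<theta>. \<omega> \<in> E a \<longrightarrow> \<omega> \<in> ?V"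
    proof (rule AE_mp, intro AE_I2 impI)
      fix \<omega>
      assume \<omega>: "\<omega> \<in> space (Pr \<theta>)" and pos: "\<forall>i\<in>{1..}. 0 < L (X i \<omega>) \<theta>" and "\<omega> \<in> E a"
      then obtain n where n: "1 \<le> n" and le: "p_stat L est1 est0 n (\<lambda>i. X i \<omega>) \<le> ennreal a"
        by (auto simp: E_def)
      \<comment> \<open>\<open>est0_arg_max\<close> speaks about points of the product space, hence
        the extensional restriction; \<open>max_likelihood\<close> feeds the same restriction to
        \<open>est0\<close>.\<close>
      let ?x = "\<lambda>i\<in>{1..n}. X i \<omega>"
      have "?x \<in> space (PiM {1..n} (\<lambda>_. D))"
        using measurable_space[OF X_meas] \<omega> by (auto simp: space_PiM space_Pr)
      from est0_arg_max[OF n this]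
      have "(\<Prod>i=1..n. L (?x i) \<theta>) \<le> (\<Prod>i=1..n. L (?x i) (est0 n ?x))"
        using \<theta>0 by (auto simp: is_arg_max_def not_less)
      then have "(\<Prod>i=1..n. L (X i \<omega>) \<theta>) \<le> max_likelihood L est0 n (\<lambda>i. X i \<omega>)"
        by (simp add: max_likelihood_def)
      moreover have "0 < (\<Prod>i=1..n. L (X i \<omega>) \<theta>)"
        using pos by (intro prod_pos) auto
      ultimately have "ennreal (1 / a) \<le> Y n (\<lambda>i. X i \<omega>)"
        unfolding Y_def by (intro p_stat_le_imp_ratio_ge[OF L_nonneg a _ _ le])
      with \<omega> show "\<omega> \<in> ?V"
        by auto
    qed
    then have "emeasure (Pr \<theta>) (E a) \<le> emeasure (Pr \<theta>) ?V"
      using V(1) by (rule emeasure_mono_AE)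
    also have "\<dots> = ennreal a * (ennreal (1 / a) * emeasure (Pr \<theta>) ?V)"
      using a by (simp add: mult.assoc[symmetric] flip: ennreal_mult)
    also have "\<dots> \<le> ennreal a * 1"
      using V(2) by (intro mult_left_mono) auto
    finally show ?thesis
      by simp
  qed
  have E_le: "emeasure (Pr \<theta>) (E a) \<le> ennreal a" if \<theta>: "\<theta> \<in> \<Theta>0" and a: "0 \<le> a" for \<theta> a
  proof (cases "a = 0")
    \<comment> \<open>Level 0 admits no threshold \<open>1 / a\<close>. Instead \<open>E 0\<close>
      lies in \<open>E b\<close> for every positive \<open>b\<close>, and \<open>b\<close> is let
      tend to 0.\<close>
    case True
    have "emeasure (Pr \<theta>) (E 0) \<le> ennreal b" if "0 < b" for b
    proof -
      have "E 0 \<subseteq> E b"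
        using that by (auto simp: E_def)
      then have "emeasure (Pr \<theta>) (E 0) \<le> emeasure (Pr \<theta>) (E b)"
        using E_meas Pr[of \<theta>] null \<theta> by (intro emeasure_mono) auto
      with E_pos[OF \<theta> that] show ?thesis
        by (rule order_trans[rotated])
    qed
    then have "emeasure (Pr \<theta>) (E 0) \<le> 0 + ennreal b" if "0 < b" for b
      using that by simp
    from ennreal_le_epsilon[OF this] show ?thesis
      by (simp add: True)
  next
    case False
    with E_pos[OF \<theta>, of a] a show ?thesis
      by simp
  qed
  \<comment> \<open>The index \<open>n\<close> may depend on the outcome in any way, which is how an
    arbitrary \<open>N\<close> is accommodated.\<close>
  have valid: "valid_p_value F Pr \<Theta>0 p"
    if meas: "p \<in> borel_measurable F"
      and ex: "\<And>\<omega>. \<omega> \<in> space F \<Longrightarrow> \<exists>n\<ge>1. p \<omega> = p_stat L est1 est0 n (\<lambda>i. X i \<omega>)" for p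
    unfolding valid_p_value_def
  proof (intro conjI meas allI impI SUP_least)
    fix a :: real and \<theta>
    assume a: "0 \<le> a \<and> a \<le> 1" and \<theta>: "\<theta> \<in> \<Theta>0"
    have "{\<omega> \<in> space F. p \<omega> \<le> ennreal a} \<subseteq> E a"
      using ex by (fastforce simp: E_def)
    then have "emeasure (Pr \<theta>) {\<omega> \<in> space F. p \<omega> \<le> ennreal a} \<le> emeasure (Pr \<theta>) (E a)"
      using E_meas Pr[of \<theta>] null \<theta> by (intro emeasure_mono) auto
    also have "\<dots> \<le> ennreal a"
      using E_le \<theta> a by blast
    finally show "emeasure (Pr \<theta>) {\<omega> \<in> space F. p \<omega> \<le> ennreal a} \<le> ennreal a" .
  qed
  have min_eq: "p_stat_min L est1 est0 n x = (MIN s\<in>{1..n}. p_stat L est1 est0 s x)" for n x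
    by (simp add: p_stat_min_def p_stat_def)
  have min_meas: "(\<lambda>\<omega>. p_stat_min L est1 est0 n (\<lambda>i. X i \<omega>)) \<in> borel_measurable F" for n
    unfolding min_eq by (intro borel_measurable_Min p_meas) auto
  show ?thesis
  proof (intro conjI valid)
    show "(\<lambda>\<omega>. p_stat L est1 est0 (N \<omega>) (\<lambda>i. X i \<omega>)) \<in> borel_measurable F"
      by (rule measurable_compose_countable[OF p_meas N(1)])
    show "(\<lambda>\<omega>. p_stat_min L est1 est0 (N \<omega>) (\<lambda>i. X i \<omega>)) \<in> borel_measurable F"
      by (rule measurable_compose_countable[OF min_meas N(1)])
  next
    fix \<omega>
    assume \<omega>: "\<omega> \<in> space F"
    show "\<exists>n\<ge>1. p_stat L est1 est0 (N \<omega>) (\<lambda>i. X i \<omega>) = p_stat L est1 est0 n (\<lambda>i. X i \<omega>)"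
      using N(2)[OF \<omega>] by blast
    \<comment> \<open>\<open>N \<omega> \<ge> 1\<close> makes the index set non-empty, so the
      minimum is attained and is itself a p-statistic at some time.\<close>
    have "(MIN s\<in>{1..N \<omega>}. p_stat L est1 est0 s (\<lambda>i. X i \<omega>)) \<in> (\<lambda>s. p_stat L est1 est0 s (\<lambda>i. X i \<omega>)) ` {1..N \<omega>}"
      using N(2)[OF \<omega>] by (intro Min_in) auto
    then show "\<exists>n\<ge>1. p_stat_min L est1 est0 (N \<omega>) (\<lambda>i. X i \<omega>) = p_stat L est1 est0 n (\<lambda>i. X i \<omega>)"
      unfolding min_eq by auto
  qed
qed

end
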